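(* Let $x_1,\dots,x_n$ be fixed covariates, $f_0$ a fixed unknown function, and $y_i=f_0(x_i)+\epsilon_i$, $i=1,\dots,n$, with $\epsilon=(\epsilon_1,\dots,\epsilon_n)^T\sim N(0,\Sigma)$ for a known covariance matrix $\Sigma$. Let $Y=(y_1,\dots,y_n)^T$, let $Z\sim N(0,\Sigma)$ be independent of $Y$, let $\tau>0$, and set $f(Y)=Y+\tau Z$, $g(Y)=Y-\frac1\tau Z$. Let $a_1,\dots,a_p$ be basis functions chosen on the basis of $f(Y)$, write $a(x)=(a_1(x),\dots,a_p(x))^T$, and let $A$ be the $n\times p$ matrix with $i$th row $a(x_i)^T$, with $A^TA$ invertible. Define $$\widehat\beta(A)=\arg\min_\beta\|g(Y)-A\beta\|^2=(A^TA)^{-1}A^Tg(Y),\qquad \beta^*(A)=\arg\min_\beta\mathbb{E}\left[\|Y-A\beta\|^2\right]=(A^TA)^{-1}A^T(f_0(x_1),\dots,f_0(x_n))^T$$ ($A$ being treated as fixed in the expectation), and $\widehat\mu_{x_i}(A)=a(x_i)^T\widehat\beta(A)$, $\mu^*_{x_i}(A)=a(x_i)^T\beta^*(A)$. Then, conditionally on $f(Y)$ (hence with $A$ fixed), for each $i$, $$\widehat\mu_{x_i}(A)\sim N\left(\mu^*_{x_i}(A),\,(1+\tau^{-2})\,a(x_i)^T(A^TA)^{-1}A^T\Sigma A(A^TA)^{-1}a(x_i)\right),$$ and $$\widehat\mu_{x_i}(A)\pm z_{\alpha/2}\sqrt{(1+\tau^{-2})\,a(x_i)^T(A^TA)^{-1}A^T\Sigma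 A(A^TA)^{-1}a(x_i)}$$ is a $1-\alpha$ confidence interval for $\mu^*_{x_i}(A)$.
   Context: $\alpha\in(0,1)$ and $z_{\alpha/2}$ is the upper $\alpha/2$ quantile of the standard normal distribution. "$1-\alpha$ confidence interval" means that the interval contains $\mu^*_{x_i}(A)$ with probability $1-\alpha$ (conditionally on $f(Y)$).
   Formalization: Coverage exactly 1−α is asserted only where the displayed variance is nonzero, and coverage at least 1−α always; if the variance is 0 (e.g. a(x_i)=0 or singular Σ), the interval is a single point with coverage 1, so exact coverage fails there. *)

theory Defs
  imports "HOL-Probability.Probability"
begin

text \<open>
  The one-dimensional normal law with mean \<open>m\<close> and variance \<open>v \<ge> 0\<close>. For \<open>v = 0\<close> it is the
  point mass at \<open>m\<close>. Note that \<open>normal_density\<close> expects the standard deviation.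
\<close>

definition normal_law :: "real \<Rightarrow> real \<Rightarrow> real measure" where
  "normal_law m v =
     (if v = 0 then return borel m
      else density lborel (\<lambda>t. ennreal (normal_density m (sqrt v) t)))"

definition std_normal_upper_quantile :: "real \<Rightarrow> real" where
  "std_normal_upper_quantile q = (THE z. measure std_normal_distribution {z<..} = q)"

text \<open>Singular covariance matrices are allowed.\<close>

definition covariance_matrix :: "real^'n^'n \<Rightarrow> bool" where
  "covariance_matrix S \<longleftrightarrow> transpose S = S \<and> (\<forall>c. 0 \<le> c \<bullet> (S *v c))"

text \<open>
  A random vector is multivariate normal if all its linear functionals are univariate normal;
  this form of the definition includes degenerate normal vectors.
\<close>

definition multivariate_normal ::
    "'w measure \<Rightarrow> ('w \<Rightarrow> real^'n) \<Rightarrow> real^'n \<Rightarrow> real^'n^'n \<Rightarrow> bool" where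
  "multivariate_normal M X m S \<longleftrightarrow>
     X \<in> borel_measurable M \<and>
     (\<forall>c. distr M borel (\<lambda>\<omega>. c \<bullet> X \<omega>) = normal_law (c \<bullet> m) (c \<bullet> (S *v c)))"

definition generated_by :: "'w measure \<Rightarrow> ('w \<Rightarrow> 'b::topological_space) \<Rightarrow> 'w measure" where
  "generated_by M V = vimage_algebra (space M) V borel"

text \<open>The conditional probability of the event \<open>E\<close> given \<open>V\<close>, as a random variable.\<close>

definition cond_prob_given ::
    "'w measure \<Rightarrow> ('w \<Rightarrow> 'b::topological_space) \<Rightarrow> 'w set \<Rightarrow> 'w \<Rightarrow> real" where
  "cond_prob_given M V E = real_cond_exp M (generated_by M V) (indicat_real E)"

text \<open>
  \<open>K\<close> is a regular conditional distribution of \<open>U\<close> given \<open>V\<close>: a probability kernel that is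
  measurable with respect to the sigma-algebra generated by \<open>V\<close> and that is a version of the
  conditional probabilities of all events \<open>U \<in> B\<close>.
\<close>

definition cond_distributed ::
    "'w measure \<Rightarrow> ('w \<Rightarrow> 'b::topological_space) \<Rightarrow> ('w \<Rightarrow> real) \<Rightarrow> ('w \<Rightarrow> real measure) \<Rightarrow> bool" where
  "cond_distributed M V U K \<longleftrightarrow>
     V \<in> borel_measurable M \<and>
     U \<in> borel_measurable M \<and>
     K \<in> generated_by M V \<rightarrow>\<^sub>M prob_algebra borel \<and>
     (\<forall>B\<in>sets borel. AE \<omega> in M.
        cond_prob_given M V {\<omega>' \<in> space M. U \<omega>' \<in> B} \<omega> = measure (K \<omega>) B)"

definition basis_vec :: "('p \<Rightarrow> 'x \<Rightarrow> real) \<Rightarrow> 'x \<Rightarrow> real^'p" where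
  "basis_vec b t = (\<chi> j. b j t)"

definition design_matrix :: "('n \<Rightarrow> 'x) \<Rightarrow> ('p \<Rightarrow> 'x \<Rightarrow> real) \<Rightarrow> real^'p^'n" where
  "design_matrix x b = (\<chi> i. basis_vec b (x i))"

definition beta_hat :: "real^'p^'n \<Rightarrow> real^'n \<Rightarrow> real^'p" where
  "beta_hat A y = arg_min (\<lambda>\<beta>. (norm (y - A *v \<beta>))\<^sup>2) (\<lambda>_. True)"

text \<open>The expectation is over the response \<open>Y\<close> only; the design matrix \<open>A\<close> is fixed.\<close>

definition beta_star :: "'w measure \<Rightarrow> ('w \<Rightarrow> real^'n) \<Rightarrow> real^'p^'n \<Rightarrow> real^'p" where
  "beta_star M Y A =
     arg_min (\<lambda>\<beta>. integral\<^sup>L M (\<lambda>\<omega>. (norm (Y \<omega> - A *v \<beta>))\<^sup>2)) (\<lambda>_. True)"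

definition least_squares :: "real^'p^'n \<Rightarrow> real^'n \<Rightarrow> real^'p" where
  "least_squares A y = matrix_inv (transpose A ** A) *v (transpose A *v y)"

definition fit_variance :: "real \<Rightarrow> real^'n^'n \<Rightarrow> real^'p^'n \<Rightarrow> real^'p \<Rightarrow> real" where
  "fit_variance \<tau> S A u =
     (1 + 1 / \<tau>\<^sup>2) *
     (u \<bullet> ((matrix_inv (transpose A ** A) ** transpose A ** S ** A
            ** matrix_inv (transpose A ** A)) *v u))"

end

theory Submission
  imports Defs
begin

text \<open>
  \<open>f(Y) = Y + \<tau> Z\<close> and \<open>g(Y) = Y - Z / \<tau>\<close> are jointly normal and uncorrelated, hence independent;
  the independence is read off the joint characteristic function, which factorises. As \<open>A\<close> is a
  function of \<open>f(Y)\<close>, the fit is \<open>c(f(Y)) \<bullet> g(Y)\<close> with a measurable weight vector \<open>c\<close>, so conditioning on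
  \<open>f(Y)\<close> amounts to freezing the weights, and a linear functional of \<open>g(Y) \<sim> N(m, (1 + 1 / \<tau>\<^sup>2) S)\<close> remains.

  Uniqueness of characteristic functions in several dimensions is reduced to Levy's theorem on the
  line by replacing, one coordinate at a time, the factor \<open>cis (t x\<^sub>j)\<close> by the indicator of a Borel set.
\<close>

section \<open>Characteristic functions in several dimensions\<close>

text \<open>\<open>S\<close> may be singular, so the vectors need not have densities and
  independence cannot be read off a factorised density; characteristic functions treat all cases
  alike. The second obstacle is measurability. Conditioning needs the weights to be a Borel function
  of every possible value of \<open>fY\<close>, while the Gram matrix is known to be invertible only
  for the values attained on \<open>space M\<close>, and \<open>matrix_inv\<close> is a choice.
  Cramer's rule supplies a total Borel formula that agrees with the inverse wherever one exists.
  Singularity returns at the end: where the variance of the fit is zero, the interval shrinks to a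
  point and covers with conditional probability 1 instead of 1 - \<alpha>.\<close>

lemma borel_measurable_cis [measurable]: "cis \<in> borel_measurable borel"
  unfolding cis_conv_exp[abs_def] by measurable

text \<open>Levy's theorem speaks of probability laws. Normalising the weight to a density turns a
  weighted integral of \<open>cis (s * f x)\<close> into the characteristic function of such a law,
  up to the factor \<open>c\<close>.\<close>

lemma weighted_distribution:
  fixes f w :: "'a \<Rightarrow> real"
  assumes "prob_space M" and f: "f \<in> borel_measurable M" and w: "w \<in> borel_measurable M"
    and bd: "\<And>x. 0 \<le> w x" "\<And>x. w x \<le> K" and c: "c = (\<integral>x. w x \<partial>M)" "0 < c"
  defines "D \<equiv> distr (density M (\<lambda>x. ennreal (w x / c))) borel f"
  shows "real_distribution D"
    and "char D s = (\<integral>x. w x *\<^sub>R cis (s * f x) \<partial>M) /\<^sub>R c"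
    and "B \<in> sets borel \<Longrightarrow> measure D B = (\<integral>x. w x * indicat_real B (f x) \<partial>M) / c"
proof -
  interpret prob_space M by fact
  note [measurable] = f w
  have int: "integrable M w"
    by (rule integrable_const_bound[of _ K]) (use bd in auto)
  interpret E: prob_space "density M (\<lambda>x. ennreal (w x / c))"
  proof
    have "(\<integral>\<^sup>+ x. ennreal (w x / c) \<partial>M) = ennreal (\<integral>x. w x / c \<partial>M)"
      using int bd c by (intro nn_integral_eq_integral) auto
    also have "\<dots> = 1" using c by simp
    finally show "emeasure (density M (\<lambda>x. ennreal (w x / c))) (space (density M (\<lambda>x. ennreal (w x / c)))) = 1"
      by (simp add: emeasure_density cong: nn_integral_cong)
  qed
  show "real_distribution D" unfolding D_def by (rule E.real_distribution_distr) simp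
  show "char D s = (\<integral>x. w x *\<^sub>R cis (s * f x) \<partial>M) /\<^sub>R c"
  proof -
    have "char D s = (\<integral>x. cis (s * f x) \<partial>density M (\<lambda>x. ennreal (w x / c)))"
      unfolding char_def D_def cis_conv_exp by (subst integral_distr) auto
    also have "\<dots> = (\<integral>x. (w x / c) *\<^sub>R cis (s * f x) \<partial>M)"
      using bd c by (intro integral_density) auto
    also have "\<dots> = (\<integral>x. inverse c *\<^sub>R (w x *\<^sub>R cis (s * f x)) \<partial>M)"
      by (simp add: divide_inverse mult.commute)
    finally show ?thesis by (simp del: scaleR_scaleR)
  qed
  show "measure D B = (\<integral>x. w x * indicat_real B (f x) \<partial>M) / c" if [measurable]: "B \<in> sets borel"
  proof -
    have "measure D B = (\<integral>x. indicat_real B x \<partial>D)"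
      by (simp add: D_def)
    also have "\<dots> = (\<integral>x. indicat_real B (f x) \<partial>density M (\<lambda>x. ennreal (w x / c)))"
      unfolding D_def by (subst integral_distr) auto
    also have "\<dots> = (\<integral>x. (w x / c) * indicat_real B (f x) \<partial>M)"
      using bd c by (subst integral_density) auto
    also have "\<dots> = (\<integral>x. (w x * indicat_real B (f x)) / c \<partial>M)"
      by simp
    finally show ?thesis by simp
  qed
qed

lemma weighted_Levy_uniqueness_nonneg:
  fixes f w :: "'a \<Rightarrow> real"
  assumes "prob_space M" "prob_space N"
    and "f \<in> borel_measurable M" "w \<in> borel_measurable M"
    and "f \<in> borel_measurable N" "w \<in> borel_measurable N"
    and bd: "\<And>x. 0 \<le> w x" "\<And>x. w x \<le> K" and pos: "0 < (\<integral>x. w x \<partial>M)"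
    and eq: "\<And>s. (\<integral>x. w x *\<^sub>R cis (s * f x) \<partial>M) = (\<integral>x. w x *\<^sub>R cis (s * f x) \<partial>N)"
    and B: "B \<in> sets borel"
  shows "(\<integral>x. w x * indicat_real B (f x) \<partial>M) = (\<integral>x. w x * indicat_real B (f x) \<partial>N)"
proof -
  define c where "c = (\<integral>x. w x \<partial>M)"
  \<comment> \<open>At s = 0 the hypothesis says that the weight has the same total mass under both
    measures, so one constant normalises both.\<close>
  have "complex_of_real (\<integral>x. w x \<partial>M) = complex_of_real (\<integral>x. w x \<partial>N)"
    using eq[of 0] by (simp add: scaleR_conv_of_real)
  then have c': "c = (\<integral>x. w x \<partial>N)" by (simp add: c_def)
  note M = weighted_distribution[OF assms(1,3,4) bd c_def]
   and N = weighted_distribution[OF assms(2,5,6) bd c']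
  have "0 < c" using pos by (simp add: c_def)
  have "distr (density M (\<lambda>x. ennreal (w x / c))) borel f = distr (density N (\<lambda>x. ennreal (w x / c))) borel f"
    by (rule Levy_uniqueness) (use M N eq \<open>0 < c\<close> in auto)
  then show ?thesis
    using M(3)[OF \<open>0 < c\<close> B] N(3)[OF \<open>0 < c\<close> B] \<open>0 < c\<close> by simp
qed

text \<open>A signed weight is shifted to a positive one.\<close>

lemma weighted_Levy_uniqueness:
  fixes f h :: "'a \<Rightarrow> real"
  assumes "prob_space M" "prob_space N"
    and f: "f \<in> borel_measurable M" and h: "h \<in> borel_measurable M"
    and f': "f \<in> borel_measurable N" and h': "h \<in> borel_measurable N"
    and bd: "\<And>x. \<bar>h x\<bar> \<le> 1"
    and eq: "\<And>s. (\<integral>x. cis (s * f x) \<partial>M) = (\<integral>x. cis (s * f x) \<partial>N)"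
    and eqh: "\<And>s. (\<integral>x. h x *\<^sub>R cis (s * f x) \<partial>M) = (\<integral>x. h x *\<^sub>R cis (s * f x) \<partial>N)"
    and B[measurable]: "B \<in> sets borel"
  shows "(\<integral>x. h x * indicat_real B (f x) \<partial>M) = (\<integral>x. h x * indicat_real B (f x) \<partial>N)"
proof -
  interpret M: prob_space M by fact
  interpret N: prob_space N by fact
  note [measurable] = f h f' h'
  \<comment> \<open>The shift by 2 keeps the weight in [1, 3], so that its mass is at least 1 and
    can be divided by.\<close>
  have lo: "0 \<le> h x + 2" and hi: "h x + 2 \<le> 3" and lo1: "1 \<le> h x + 2" for x
    using bd[of x] by auto
  have intM: "integrable M h" "integrable M (\<lambda>x. h x *\<^sub>R cis (s * f x))" "integrable M (\<lambda>x. cis (s * f x))"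
     "integrable M (\<lambda>x. h x * indicat_real B (f x))" "integrable M (\<lambda>x. indicat_real B (f x))" for s
    by (rule M.integrable_const_bound[of _ 1]; use bd in \<open>auto simp: cis_conv_exp indicator_def\<close>)+
  have intN: "integrable N h" "integrable N (\<lambda>x. h x *\<^sub>R cis (s * f x))" "integrable N (\<lambda>x. cis (s * f x))"
     "integrable N (\<lambda>x. h x * indicat_real B (f x))" "integrable N (\<lambda>x. indicat_real B (f x))" for s
    by (rule N.integrable_const_bound[of _ 1]; use bd in \<open>auto simp: cis_conv_exp indicator_def\<close>)+
  \<comment> \<open>The constant weight 1: twice this equation is subtracted at the end to undo the
    shift.\<close>
  have one: "(\<integral>x. indicat_real B (f x) \<partial>M) = (\<integral>x. indicat_real B (f x) \<partial>N)"
  proof -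
    have "(\<integral>x. 1 * indicat_real B (f x) \<partial>M) = (\<integral>x. 1 * indicat_real B (f x) \<partial>N)"
      by (rule weighted_Levy_uniqueness_nonneg[OF assms(1,2), where K = 1]) (simp_all add: eq M.prob_space)
    then show ?thesis by simp
  qed
  have "1 \<le> (\<integral>x. h x + 2 \<partial>M)"
    using lo1 intM(1) by (intro M.integral_ge_const) auto
  then have "0 < (\<integral>x. h x + 2 \<partial>M)" by linarith
  moreover have "(\<integral>x. (h x + 2) *\<^sub>R cis (s * f x) \<partial>M) = (\<integral>x. (h x + 2) *\<^sub>R cis (s * f x) \<partial>N)" for s
    using eq[of s] eqh[of s] intM(2,3)[of s] intN(2,3)[of s] by (simp add: scaleR_add_left)
  ultimately have "(\<integral>x. (h x + 2) * indicat_real B (f x) \<partial>M) = (\<integral>x. (h x + 2) * indicat_real B (f x) \<partial>N)"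
    by (intro weighted_Levy_uniqueness_nonneg[OF assms(1,2) _ _ _ _ lo hi]) auto
  then show ?thesis
    using one intM(4,5) intN(4,5) by (simp add: distrib_right)
qed

theorem Levy_uniqueness_euclidean:
  fixes M N :: "'a::euclidean_space measure"
  assumes "prob_space M" "prob_space N" and sets: "sets M = sets borel" "sets N = sets borel"
    and eq: "\<And>t. (\<integral>x. cis (t \<bullet> x) \<partial>M) = (\<integral>x. cis (t \<bullet> x) \<partial>N)"
  shows "M = N"
proof -
  interpret M: prob_space M by fact
  interpret N: prob_space N by fact
  note [measurable_cong] = sets
  have box_eq: "(\<integral>x. (\<Prod>j\<in>J. indicat_real (B j) (x \<bullet> j)) *\<^sub>R cis (t \<bullet> x) \<partial>M) =
    (\<integral>x. (\<Prod>j\<in>J. indicat_real (B j) (x \<bullet> j)) *\<^sub>R cis (t \<bullet> x) \<partial>N)"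
    if "finite J" and B: "\<And>j. B j \<in> sets borel" for B t and J :: "'a set"
    using that(1)
  proof (induction J arbitrary: t)
    case empty
    then show ?case using eq by simp
  next
    case (insert j J)
    note B[measurable]
    define w where "w x = (\<Prod>j\<in>J. indicat_real (B j) (x \<bullet> j))" for x :: 'a
    have w[measurable]: "w \<in> borel_measurable borel" unfolding w_def by measurable
    have w01: "0 \<le> w x" "w x \<le> 1" for x
      unfolding w_def by (auto intro!: prod_nonneg prod_le_1 simp: indicator_def)
    have IH: "(\<integral>x. w x *\<^sub>R cis (t \<bullet> x) \<partial>M) = (\<integral>x. w x *\<^sub>R cis (t \<bullet> x) \<partial>N)" for t
      using insert.IH unfolding w_def .
    have iM: "integrable M (\<lambda>x. w x *\<^sub>R cis (t \<bullet> x))" for t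
      by (rule M.integrable_const_bound[of _ 1]) (use w01 in \<open>auto simp: cis_conv_exp\<close>)
    have iN: "integrable N (\<lambda>x. w x *\<^sub>R cis (t \<bullet> x))" for t
      by (rule N.integrable_const_bound[of _ 1]) (use w01 in \<open>auto simp: cis_conv_exp\<close>)
    \<comment> \<open>The one-dimensional lemma wants a real weight, so
      \<open>cis (t \<bullet> x)\<close> is treated through its real and imaginary parts
      \<open>p\<close>. Both are combinations of \<open>cis (t \<bullet> x)\<close> and its
      conjugate; multiplied by \<open>cis (s * (x \<bullet> j))\<close> they have frequencies
      \<open>t + s *\<^sub>R j\<close> and \<open>- t + s *\<^sub>R j\<close>, which is why the
      induction keeps the frequency arbitrary.\<close>
    have part: "(\<integral>x. (w x * p x) * indicat_real (B j) (x \<bullet> j) \<partial>M) =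
        (\<integral>x. (w x * p x) * indicat_real (B j) (x \<bullet> j) \<partial>N)"
      if [measurable]: "p \<in> borel_measurable borel" and p: "\<And>x. \<bar>p x\<bar> \<le> 1"
        and p_eq: "\<And>x. complex_of_real (p x) = a * cis (t \<bullet> x) + b * cis (- (t \<bullet> x))" for p a b
    proof (rule weighted_Levy_uniqueness[OF assms(1,2)])
      show "\<bar>w x * p x\<bar> \<le> 1" for x
        using w01[of x] p[of x] mult_mono[of "w x" 1 "\<bar>p x\<bar>" 1] by (simp add: abs_mult)
      show "(\<integral>x. cis (s * (x \<bullet> j)) \<partial>M) = (\<integral>x. cis (s * (x \<bullet> j)) \<partial>N)" for s
        using eq[of "s *\<^sub>R j"] by (simp add: inner_commute)
      have *: "(w x * p x) *\<^sub>R cis (s * (x \<bullet> j)) =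
        a * (w x *\<^sub>R cis ((t + s *\<^sub>R j) \<bullet> x)) + b * (w x *\<^sub>R cis ((- t + s *\<^sub>R j) \<bullet> x))" for x s
      proof -
        have "cis ((r + s *\<^sub>R j) \<bullet> x) = cis (r \<bullet> x) * cis (s * (x \<bullet> j))" for r
          by (simp only: cis_mult inner_add_left inner_scaleR_left inner_commute[of j x])
        from this[of t] this[of "- t"] show ?thesis
          by (simp only: scaleR_conv_of_real of_real_mult p_eq ring_distribs mult_ac inner_minus_left)
      qed
      show "(\<integral>x. (w x * p x) *\<^sub>R cis (s * (x \<bullet> j)) \<partial>M) = (\<integral>x. (w x * p x) *\<^sub>R cis (s * (x \<bullet> j)) \<partial>N)" for s
        by (simp only: * Bochner_Integration.integral_add integrable_mult_right integral_mult_right_zero iM iN IH)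
    qed auto
    have re: "(\<integral>x. (w x * cos (t \<bullet> x)) * indicat_real (B j) (x \<bullet> j) \<partial>M) =
        (\<integral>x. (w x * cos (t \<bullet> x)) * indicat_real (B j) (x \<bullet> j) \<partial>N)"
      by (rule part[of _ "1/2" "1/2"]) (auto simp: complex_eq_iff)
    have im: "(\<integral>x. (w x * sin (t \<bullet> x)) * indicat_real (B j) (x \<bullet> j) \<partial>M) =
        (\<integral>x. (w x * sin (t \<bullet> x)) * indicat_real (B j) (x \<bullet> j) \<partial>N)"
      by (rule part[of _ "- \<i>/2" "\<i>/2"]) (auto simp: complex_eq_iff)
    have W: "(\<Prod>j\<in>insert j J. indicat_real (B j) (x \<bullet> j)) *\<^sub>R cis (t \<bullet> x) =
       complex_of_real ((w x * cos (t \<bullet> x)) * indicat_real (B j) (x \<bullet> j))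
       + \<i> * complex_of_real ((w x * sin (t \<bullet> x)) * indicat_real (B j) (x \<bullet> j))" for x
    proof -
      have "(\<Prod>j\<in>insert j J. indicat_real (B j) (x \<bullet> j)) = indicat_real (B j) (x \<bullet> j) * w x"
        using insert.hyps by (simp add: w_def)
      then show ?thesis by (simp add: complex_eq_iff del: prod.insert)
    qed
    have bd: "\<bar>w x * c x * indicat_real (B j) (x \<bullet> j)\<bar> \<le> 1" if "\<And>x. \<bar>c x\<bar> \<le> 1" for x c
      using w01[of x] that[of x] mult_mono[of "w x" 1 "\<bar>c x\<bar>" 1] by (auto simp: abs_mult indicator_def)
    have "integrable M (\<lambda>x. (w x * cos (t \<bullet> x)) * indicat_real (B j) (x \<bullet> j))"
      "integrable M (\<lambda>x. (w x * sin (t \<bullet> x)) * indicat_real (B j) (x \<bullet> j))"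
      by (rule M.integrable_const_bound[of _ 1]; use bd[of "\<lambda>x. cos (t \<bullet> x)"] bd[of "\<lambda>x. sin (t \<bullet> x)"] in auto)+
    moreover have "integrable N (\<lambda>x. (w x * cos (t \<bullet> x)) * indicat_real (B j) (x \<bullet> j))"
      "integrable N (\<lambda>x. (w x * sin (t \<bullet> x)) * indicat_real (B j) (x \<bullet> j))"
      by (rule N.integrable_const_bound[of _ 1]; use bd[of "\<lambda>x. cos (t \<bullet> x)"] bd[of "\<lambda>x. sin (t \<bullet> x)"] in auto)+
    ultimately show ?case
      by (simp only: W re im Bochner_Integration.integral_add integrable_mult_right
          integral_mult_right_zero integrable_of_real integral_of_real)
  qed
  show ?thesis
  proof (rule measure_eqI_generator_eq)
    let ?E = "range (\<lambda>(a, b). box a b::'a set)"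
    show "Int_stable ?E"
      by (auto simp: Int_stable_def box_Int_box)
    show "?E \<subseteq> Pow UNIV" "sets M = sigma_sets UNIV ?E" "sets N = sigma_sets UNIV ?E"
      by (simp_all add: borel_eq_box sets)
    let ?A = "\<lambda>n::nat. box (- (real n *\<^sub>R One)) (real n *\<^sub>R One) :: 'a set"
    show "range ?A \<subseteq> ?E" "(\<Union>i. ?A i) = UNIV"
      unfolding UN_box_eq_UNIV by auto
    show "emeasure M (?A i) \<noteq> \<infinity>" for i by auto
    show "emeasure M X = emeasure N X" if X: "X \<in> ?E" for X
    proof -
      obtain l u where X: "X = box l u" using X by auto
      have ind: "(\<Prod>j\<in>Basis. indicat_real {l \<bullet> j<..<u \<bullet> j} (x \<bullet> j)) = indicat_real X x" for x
        by (auto simp: X indicator_def box_def prod_eq_1_iff intro!: prod.neutral)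
      \<comment> \<open>With every coordinate in the product and frequency 0, only the indicator of
        the box is left.\<close>
      have "complex_of_real (measure M X) = complex_of_real (measure N X)"
        using box_eq[of Basis "\<lambda>j. {l \<bullet> j<..<u \<bullet> j}" 0] sets_eq_imp_space_eq[OF sets(1)] sets_eq_imp_space_eq[OF sets(2)]
        by (simp add: ind scaleR_conv_of_real)
      then show ?thesis by (simp add: M.emeasure_eq_measure N.emeasure_eq_measure)
    qed
  qed
qed

section \<open>The normal law on the line\<close>

interpretation std_normal: real_distribution std_normal_distribution
  by (rule real_dist_normal_dist)

lemma distr_std_normal_affine:
  assumes "\<sigma> \<noteq> 0"
  shows "distr std_normal_distribution borel (\<lambda>x. m + \<sigma> * x) =
    density lborel (\<lambda>t. ennreal (normal_density m \<bar>\<sigma>\<bar> t))"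
proof -
  have "distributed std_normal_distribution lborel (\<lambda>x. x) std_normal_density"
    by (simp add: distributed_def) (rule distr_id2, simp)
  from std_normal.normal_density_affine[OF this zero_less_one assms, of m]
  have "distr std_normal_distribution lborel (\<lambda>x. m + \<sigma> * x) =
    density lborel (\<lambda>t. ennreal (normal_density m \<bar>\<sigma>\<bar> t))"
    by (simp add: distributed_def)
  then show ?thesis by (simp cong: distr_cong)
qed

text \<open>One formula covers both the point mass and the density, so that later computations need
  no case distinction on the variance.\<close>

lemma normal_law_eq_distr:
  assumes "0 \<le> v"
  shows "normal_law m v = distr std_normal_distribution borel (\<lambda>x. m + sqrt v * x)"
proof (cases "v = 0")
  case True
  then show ?thesis by (simp add: normal_law_def std_normal.distr_const)
next
  case False
  then show ?thesis using distr_std_normal_affine[of "sqrt v" m] assms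
    by (simp add: normal_law_def)
qed

lemma real_distribution_normal_law: "0 \<le> v \<Longrightarrow> real_distribution (normal_law m v)"
  by (simp add: normal_law_eq_distr)

lemma char_normal_law:
  assumes "0 \<le> v"
  shows "char (normal_law m v) s = cis (s * m) * exp (- (s\<^sup>2 * v) / 2)"
proof -
  have "char (normal_law m v) s = (\<integral>x. iexp (s * (m + sqrt v * x)) \<partial>std_normal_distribution)"
    unfolding char_def normal_law_eq_distr[OF assms] by (subst integral_distr) auto
  also have "\<dots> = (\<integral>x. cis (s * m) * iexp (s * sqrt v * x) \<partial>std_normal_distribution)"
    by (simp add: cis_conv_exp exp_add[symmetric] algebra_simps)
  also have "\<dots> = cis (s * m) * char std_normal_distribution (s * sqrt v)"
    by (simp add: char_def)
  finally show ?thesis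
    using assms by (simp add: char_std_normal_distribution power_mult_distrib exp_of_real)
qed

text \<open>Used for the expected squared error: the second moments make it finite, and the mean
  locates its minimiser.\<close>

lemma normal_law_moments:
  assumes "0 \<le> v"
  shows "integrable (normal_law m v) (\<lambda>x. x)" "(\<integral>x. x \<partial>normal_law m v) = m"
    "integrable (normal_law m v) (\<lambda>x. x\<^sup>2)"
proof -
  have i1: "integrable std_normal_distribution (\<lambda>x. x)"
    using integrable_std_normal_distribution_moment[of 1] by simp
  have i2: "integrable std_normal_distribution (\<lambda>x. x\<^sup>2)"
    by (rule integrable_std_normal_distribution_moment)
  have e1: "(\<integral>x. x \<partial>std_normal_distribution) = 0"
    using integral_std_normal_distribution_moment_odd[of 1] by simp
  have affine: "integrable std_normal_distribution (\<lambda>x. m + sqrt v * x)"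
    by (intro Bochner_Integration.integrable_add integrable_mult_right i1 std_normal.integrable_const)
  then show "integrable (normal_law m v) (\<lambda>x. x)"
    unfolding normal_law_eq_distr[OF assms] by (subst integrable_distr_eq) simp_all
  have "(\<integral>x. x \<partial>normal_law m v) = (\<integral>x. m + sqrt v * x \<partial>std_normal_distribution)"
    unfolding normal_law_eq_distr[OF assms] by (subst integral_distr) simp_all
  also have "\<dots> = m"
    by (simp only: Bochner_Integration.integral_add std_normal.integrable_const integrable_mult_right i1
        integral_mult_right_zero e1 lebesgue_integral_const std_normal.prob_space) simp
  finally show "(\<integral>x. x \<partial>normal_law m v) = m" .
  have "(m + sqrt v * x)\<^sup>2 = m\<^sup>2 + (2 * m * sqrt v * x + v * x\<^sup>2)" for x
    using assms by (simp add: power2_sum power_mult_distrib)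
  then have "integrable std_normal_distribution (\<lambda>x. (m + sqrt v * x)\<^sup>2)"
    by (simp only:) (intro Bochner_Integration.integrable_add integrable_mult_right i1 i2
        std_normal.integrable_const)
  then show "integrable (normal_law m v) (\<lambda>x. x\<^sup>2)"
    unfolding normal_law_eq_distr[OF assms] by (subst integrable_distr_eq) simp_all
qed

lemma std_normal_singleton: "measure std_normal_distribution {x} = 0"
proof -
  have "AE y in lborel. y \<in> {x} \<longrightarrow> ennreal (std_normal_density y) = 0"
    using AE_lborel_singleton[of x] by eventually_elim simp
  then have "{x} \<in> null_sets std_normal_distribution"
    by (subst null_sets_density_iff) auto
  then show ?thesis by (simp add: measure_def null_setsD1)
qed

text \<open>The density is positive, so an interval of mass zero would be a Lebesgue null set. The
  cdf is therefore strictly increasing, which makes the quantile unique.\<close>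

lemma std_normal_interval_pos:
  assumes "a < b"
  shows "0 < measure std_normal_distribution {a<..b}"
proof (rule ccontr)
  assume "\<not> ?thesis"
  then have "emeasure std_normal_distribution {a<..b} = 0"
    by (simp add: std_normal.emeasure_eq_measure zero_less_measure_iff)
  then have "AE x in lborel. ennreal (std_normal_density x) * indicator {a<..b} x = 0"
    by (simp add: emeasure_density nn_integral_0_iff_AE)
  then have "AE x in lborel. x \<notin> {a<..b}"
    by eventually_elim (use normal_density_pos[of 1 0] in \<open>auto simp: indicator_def less_le split: if_splits\<close>)
  then have "emeasure lborel {a<..b} = 0"
    by (simp add: AE_iff_measurable[OF _ refl] greaterThanAtMost_def greaterThan_def atMost_def Int_def)
  with assms show False by simp
qed

lemma std_normal_uminus: "distr std_normal_distribution borel uminus = std_normal_distribution"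
  using distr_std_normal_affine[of "-1" 0] by simp

lemma std_normal_lower_tail:
  "measure std_normal_distribution {..< - z} = measure std_normal_distribution {z<..}"
proof -
  have "measure std_normal_distribution {z<..} = measure (distr std_normal_distribution borel uminus) {z<..}"
    by (simp add: std_normal_uminus)
  also have "\<dots> = measure std_normal_distribution (uminus -` {z<..})"
    by (subst measure_distr) auto
  also have "uminus -` {z<..} = {..< - z}" by auto
  finally show ?thesis ..
qed

lemma std_normal_upper_tail: "measure std_normal_distribution {z<..} = 1 - cdf std_normal_distribution z"
proof -
  have "{z<..} = UNIV - {..z}" by auto
  then show ?thesis using std_normal.prob_compl[of "{..z}"] by (simp add: cdf_def)
qed

text \<open>The quantile is a definite description and is meaningful only after existence and
  uniqueness are proved: the intermediate value theorem applies because the law has no atoms, and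
  strict monotonicity of the cdf does the rest.\<close>

lemma std_normal_upper_quantile:
  assumes "0 < q" "q < 1"
  shows "measure std_normal_distribution {std_normal_upper_quantile q<..} = q"
proof -
  let ?F = "cdf std_normal_distribution"
  have strict: "?F a < ?F b" if "a < b" for a b
    using std_normal.cdf_diff_eq[OF that] std_normal_interval_pos[OF that] by simp
  have "\<forall>\<^sub>F x in at_bot. ?F x < 1 - q"
    using std_normal.cdf_lim_at_bot assms by (intro order_tendstoD) auto
  then obtain a where a: "?F a < 1 - q"
    by (auto simp: eventually_at_bot_linorder)
  have "\<forall>\<^sub>F x in at_top. 1 - q < ?F x"
    using std_normal.cdf_lim_at_top_prob assms by (intro order_tendstoD) auto
  then obtain b where b: "1 - q < ?F b"
    by (auto simp: eventually_at_top_linorder)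
  have "a \<le> b"
    using a b std_normal.cdf_nondecreasing[of b a] by linarith
  then obtain z where z: "?F z = 1 - q"
    using IVT[of ?F a "1 - q" b] a b std_normal_singleton by (auto simp: std_normal.isCont_cdf)
  have "\<exists>!z. measure std_normal_distribution {z<..} = q"
  proof
    show "measure std_normal_distribution {z<..} = q" by (simp add: std_normal_upper_tail z)
    show "y = z" if "measure std_normal_distribution {y<..} = q" for y
      using that strict[of y z] strict[of z y] z by (cases y z rule: linorder_cases) (auto simp: std_normal_upper_tail)
  qed
  then show ?thesis unfolding std_normal_upper_quantile_def by (rule theI')
qed

text \<open>By symmetry each half-line from 0 has mass 1/2, so \<open>q < 1 / 2\<close> forces
  \<open>z\<close> to be positive. Then the two tails are disjoint, and each has mass
  \<open>q\<close>.\<close>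

lemma std_normal_central_interval:
  assumes "0 < q" "q < 1 / 2"
  defines "z \<equiv> std_normal_upper_quantile q"
  shows "0 < z" "measure std_normal_distribution {- z..z} = 1 - 2 * q"
proof -
  have q: "measure std_normal_distribution {z<..} = q"
    unfolding z_def using assms by (intro std_normal_upper_quantile) auto
  have "measure std_normal_distribution ({0<..} \<union> {..<0}) + measure std_normal_distribution {0} = 1"
    by (subst std_normal.finite_measure_Union[symmetric]) (auto simp: std_normal.prob_eq_1 intro!: AE_I2)
  moreover have "measure std_normal_distribution ({0<..} \<union> {..<0}) =
     measure std_normal_distribution {0<..} + measure std_normal_distribution {..<0}"
    by (rule std_normal.finite_measure_Union) auto
  ultimately have half: "measure std_normal_distribution {0<..} = 1 / 2"
    using std_normal_lower_tail[of 0] by (simp add: std_normal_singleton)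
  show "0 < z"
  proof (rule ccontr)
    assume "\<not> 0 < z"
    then have "measure std_normal_distribution {0<..} \<le> measure std_normal_distribution {z<..}"
      by (intro std_normal.finite_measure_mono) auto
    with half q assms show False by simp
  qed
  have "measure std_normal_distribution ({z<..} \<union> {..< - z}) = 2 * q"
    using \<open>0 < z\<close> q std_normal_lower_tail[of z] by (subst std_normal.finite_measure_Union) auto
  moreover have "{- z..z} = UNIV - ({z<..} \<union> {..< - z})" by auto
  ultimately show "measure std_normal_distribution {- z..z} = 1 - 2 * q"
    using std_normal.prob_compl[of "{z<..} \<union> {..< - z}"] by simp
qed

text \<open>For zero variance the half-width \<open>h\<close> vanishes and the interval is the
  single point carrying all the mass; otherwise standardising reduces it to the standard normal
  interval.\<close>

lemma normal_law_central_interval: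
  assumes "0 < q" "q < 1 / 2" "0 \<le> v"
  defines "h \<equiv> std_normal_upper_quantile q * sqrt v"
  shows "measure (normal_law m v) {m - h..m + h} = (if v = 0 then 1 else 1 - 2 * q)"
proof (cases "v = 0")
  case True
  then show ?thesis by (simp add: h_def normal_law_def measure_return)
next
  case False
  let ?z = "std_normal_upper_quantile q"
  have "sqrt v > 0" using False assms by simp
  then have "m + sqrt v * x \<in> {m - h..m + h} \<longleftrightarrow> x \<in> {- ?z..?z}" for x
    using mult_le_cancel_left_pos[of "sqrt v" "- ?z" x] mult_le_cancel_left_pos[of "sqrt v" x ?z]
    by (simp add: h_def mult.commute)
  then have "(\<lambda>x. m + sqrt v * x) -` {m - h..m + h} = {- ?z..?z}"
    by (intro set_eqI) (simp only: vimage_eq)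
  then show ?thesis
    using std_normal_central_interval(2)[of q] assms False
    by (simp add: normal_law_eq_distr measure_distr)
qed

section \<open>Conditional probabilities under independence\<close>

lemma sets_generated_by:
  "sets (generated_by M V) = {V -` C \<inter> space M |C. C \<in> sets borel}"
  by (simp add: generated_by_def sets_vimage_algebra2)

lemma space_generated_by [simp]: "space (generated_by M V) = space M"
  by (simp add: generated_by_def)

lemma subalgebra_generated_by:
  "V \<in> borel_measurable M \<Longrightarrow> subalgebra M (generated_by M V)"
  by (auto simp: subalgebra_def sets_generated_by)

lemma measurable_generated_by: "f \<in> borel \<rightarrow>\<^sub>M N \<Longrightarrow> (\<lambda>\<omega>. f (V \<omega>)) \<in> generated_by M V \<rightarrow>\<^sub>M N"
  unfolding generated_by_def
  by (rule measurable_compose[OF measurable_vimage_algebra1]) auto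

text \<open>Independence makes the law of the pair a product, so the conditional probability is the
  mass of the section of \<open>D\<close> at the observed \<open>V\<close>. General sets
  \<open>D\<close>, not only rectangles, are needed because the events of interest couple
  \<open>V\<close> and \<open>G\<close>. They are taken from the product sigma-algebra, since no
  countable base is assumed that would identify it with the Borel sets of the product space.\<close>

lemma (in prob_space) cond_prob_given_indep:
  fixes V G :: "'a \<Rightarrow> 'v::topological_space"
  assumes ind: "indep_var borel V borel G" and D: "D \<in> sets (borel \<Otimes>\<^sub>M borel)"
  shows "AE \<omega> in M. cond_prob_given M V {\<omega>' \<in> space M. (V \<omega>', G \<omega>') \<in> D} \<omega> =
    measure (distr M borel G) {g. (V \<omega>, g) \<in> D}"
proof -
  have V[measurable]: "V \<in> borel_measurable M" and G[measurable]: "G \<in> borel_measurable M"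
    and joint: "distr M borel V \<Otimes>\<^sub>M distr M borel G = distr M (borel \<Otimes>\<^sub>M borel) (\<lambda>\<omega>. (V \<omega>, G \<omega>))"
    using ind by (auto simp: indep_var_distribution_eq)
  note [measurable] = D
  interpret G: prob_space "distr M borel G" by (rule prob_space_distr) simp
  interpret finite_measure_subalgebra M "generated_by M V"
    by unfold_locales (simp add: subalgebra_generated_by)
  define q where "q v = measure (distr M borel G) (Pair v -` D)" for v
  have "(\<lambda>v. emeasure (distr M borel G) (Pair v -` D)) \<in> borel_measurable borel"
    by (rule G.measurable_emeasure_Pair) (simp cong: sets_pair_measure_cong)
  then have q[measurable]: "q \<in> borel_measurable borel"
    unfolding q_def measure_def by measurable
  have q1: "q v \<le> 1" "0 \<le> q v" for v unfolding q_def by simp_all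
  let ?E = "{\<omega>' \<in> space M. (V \<omega>', G \<omega>') \<in> D}"
  have "(\<lambda>\<omega>. (V \<omega>, G \<omega>)) -` D \<inter> space M \<in> events"
    by (rule measurable_sets[OF _ D]) simp
  then have E[measurable]: "?E \<in> events" by (simp add: vimage_def Int_def conj_commute)
  have "AE \<omega> in M. real_cond_exp M (generated_by M V) (indicat_real ?E) \<omega> = q (V \<omega>)"
  proof (rule real_cond_exp_charact)
    show "integrable M (indicat_real ?E)"
      using E by (intro integrable_real_indicator) (auto simp: emeasure_eq_measure)
    show "integrable M (\<lambda>\<omega>. q (V \<omega>))"
      by (rule integrable_const_bound[of _ 1]) (use q1 in auto)
    show "(\<lambda>\<omega>. q (V \<omega>)) \<in> borel_measurable (generated_by M V)"
      by (rule measurable_generated_by) simp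
    fix A assume "A \<in> sets (generated_by M V)"
    then obtain C where A: "A = V -` C \<inter> space M" and C[measurable]: "C \<in> sets borel"
      by (auto simp: sets_generated_by)
    have A_sets[measurable]: "A \<in> sets M" unfolding A by measurable
    have "ennreal (\<integral>\<omega>\<in>A. indicat_real ?E \<omega> \<partial>M) = emeasure M (A \<inter> ?E)"
      by (simp add: set_lebesgue_integral_def indicator_inter_arith[symmetric] emeasure_eq_measure)
    \<comment> \<open>The event \<open>A\<close> constrains \<open>V\<close> alone, so it cuts
      \<open>D\<close> down to the strip over \<open>C\<close>, and Fubini's theorem then integrates
      the section masses over \<open>C\<close>.\<close>
    also have "A \<inter> ?E = (\<lambda>\<omega>. (V \<omega>, G \<omega>)) -` (D \<inter> C \<times> UNIV) \<inter> space M"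
      by (auto simp: A)
    also have "emeasure M \<dots> = emeasure (distr M borel V \<Otimes>\<^sub>M distr M borel G) (D \<inter> C \<times> UNIV)"
      unfolding joint by (subst emeasure_distr) auto
    also have "\<dots> = (\<integral>\<^sup>+v. emeasure (distr M borel G) (Pair v -` (D \<inter> C \<times> UNIV)) \<partial>distr M borel V)"
      by (rule G.emeasure_pair_measure_alt) (simp cong: sets_pair_measure_cong)
    also have "\<dots> = (\<integral>\<^sup>+v. ennreal (indicator C v * q v) \<partial>distr M borel V)"
    proof (rule nn_integral_cong)
      fix v
      have "Pair v -` (D \<inter> C \<times> UNIV) = (if v \<in> C then Pair v -` D else {})" by auto
      then show "emeasure (distr M borel G) (Pair v -` (D \<inter> C \<times> UNIV)) = ennreal (indicator C v * q v)"
        by (simp add: q_def G.emeasure_eq_measure)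
    qed
    also have "\<dots> = (\<integral>\<^sup>+\<omega>. ennreal (indicator A \<omega> * q (V \<omega>)) \<partial>M)"
      by (subst nn_integral_distr) (auto simp: A intro!: nn_integral_cong split: split_indicator)
    also have "\<dots> = ennreal (\<integral>\<omega>\<in>A. q (V \<omega>) \<partial>M)"
      unfolding set_lebesgue_integral_def real_scaleR_def
      by (intro nn_integral_eq_integral integrable_const_bound[of _ 1])
         (use q1 in \<open>auto split: split_indicator\<close>)
    finally show "(\<integral>\<omega>\<in>A. indicat_real ?E \<omega> \<partial>M) = (\<integral>\<omega>\<in>A. q (V \<omega>) \<partial>M)"
      by (subst (asm) ennreal_inj)
         (use q1 in \<open>auto simp: set_lebesgue_integral_def intro!: integral_nonneg_AE\<close>)
  qed
  then show ?thesis by (simp add: cond_prob_given_def q_def vimage_def)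
qed

section \<open>Least squares\<close>

lemma inner_transpose_vector:
  fixes A :: "real^'p^'n"
  shows "\<beta> \<bullet> (transpose A *v y) = (A *v \<beta>) \<bullet> y"
  using dot_lmul_matrix[of y A \<beta>] by (simp add: inner_commute)

lemma inner_gram:
  fixes A :: "real^'p^'n"
  shows "\<beta> \<bullet> ((transpose A ** A) *v \<gamma>) = (A *v \<beta>) \<bullet> (A *v \<gamma>)"
  by (simp only: matrix_vector_mul_assoc[symmetric] inner_transpose_vector)

lemma matrix_inv_mult_cancel:
  fixes B :: "real^'n^'n"
  assumes "invertible B"
  shows "B *v (matrix_inv B *v y) = y" "matrix_inv B *v (B *v y) = y"
proof -
  have "B ** matrix_inv B = mat 1 \<and> matrix_inv B ** B = mat 1"
    unfolding matrix_inv_def by (rule someI_ex) (use assms in \<open>simp add: invertible_def\<close>)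
  then show "B *v (matrix_inv B *v y) = y" "matrix_inv B *v (B *v y) = y"
    by (simp_all add: matrix_vector_mul_assoc)
qed

lemma least_squares_normal_equation:
  fixes A :: "real^'p^'n"
  assumes "invertible (transpose A ** A)"
  shows "(transpose A ** A) *v least_squares A y = transpose A *v y"
  unfolding least_squares_def by (rule matrix_inv_mult_cancel[OF assms])

lemma inj_of_invertible_gram:
  fixes A :: "real^'p^'n"
  assumes "invertible (transpose A ** A)" "A *v \<beta> = 0"
  shows "\<beta> = 0"
  using matrix_inv_mult_cancel(2)[OF assms(1), of \<beta>] assms(2)
  by (simp add: matrix_vector_mul_assoc[symmetric])

text \<open>The normal equation makes the residual orthogonal to the range of
  \<open>A\<close>.\<close>

lemma least_squares_pythagoras:
  fixes A :: "real^'p^'n"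
  assumes "invertible (transpose A ** A)"
  shows "(norm (y - A *v \<beta>))\<^sup>2 =
    (norm (y - A *v least_squares A y))\<^sup>2 + (norm (A *v (\<beta> - least_squares A y)))\<^sup>2"
proof -
  let ?b = "least_squares A y" and ?d = "\<beta> - least_squares A y"
  have "(A *v ?d) \<bullet> (y - A *v ?b) = ?d \<bullet> (transpose A *v y) - ?d \<bullet> ((transpose A ** A) *v ?b)"
    by (simp only: inner_gram inner_diff_right inner_transpose_vector)
  also have "\<dots> = 0" by (simp add: least_squares_normal_equation[OF assms])
  finally have orth: "(A *v ?d) \<bullet> (y - A *v ?b) = 0" .
  have "y - A *v \<beta> = (y - A *v ?b) - A *v ?d"
    by (simp add: matrix_vector_mult_diff_distrib)
  then show ?thesis using orth
    by (simp only: power2_norm_eq_inner inner_diff_left inner_diff_right inner_commute)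
qed

text \<open>Both minimisation problems have this shape. A minimiser cannot exceed the value at
  \<open>b\<close>, which forces \<open>A *v (\<beta> - b) = 0\<close>, and an invertible Gram
  matrix makes \<open>A\<close> injective.\<close>

lemma is_arg_min_plus_norm:
  fixes A :: "real^'p^'n" and F :: "real^'p \<Rightarrow> real"
  assumes inv: "invertible (transpose A ** A)"
    and F: "\<And>\<beta>. F \<beta> = c + (norm (A *v (\<beta> - b)))\<^sup>2"
  shows "is_arg_min F (\<lambda>_. True) \<beta> \<longleftrightarrow> \<beta> = b"
proof
  assume "is_arg_min F (\<lambda>_. True) \<beta>"
  then have "F \<beta> \<le> F b" by (auto simp: is_arg_min_def not_less)
  then have "A *v (\<beta> - b) = 0" by (simp add: F)
  then show "\<beta> = b" using inj_of_invertible_gram[OF inv] by (metis eq_iff_diff_eq_0)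
qed (auto simp: is_arg_min_def F not_less)

text \<open>\<open>arg_min\<close> is a Hilbert choice, so it is pinned down only by uniqueness;
  hence the equivalences, rather than mere minimality, in the lemmas on least squares.\<close>

lemma arg_min_eqI:
  assumes "\<And>y. is_arg_min f P y \<longleftrightarrow> y = x"
  shows "arg_min f P = x"
  unfolding arg_min_def assms by simp

lemma is_arg_min_least_squares:
  fixes A :: "real^'p^'n"
  assumes "invertible (transpose A ** A)"
  shows "is_arg_min (\<lambda>\<beta>. (norm (y - A *v \<beta>))\<^sup>2) (\<lambda>_. True) \<beta> \<longleftrightarrow> \<beta> = least_squares A y"
  by (rule is_arg_min_plus_norm[OF assms]) (rule least_squares_pythagoras[OF assms])

text \<open>Splitting into variance and bias: the risk of predicting \<open>z\<close> is the sum of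
  the coordinate variances plus the squared distance from \<open>m\<close> to \<open>z\<close>. Only
  the second term depends on \<open>z\<close>, so the problem becomes ordinary least squares for the
  mean; correlations between coordinates do not enter.\<close>

lemma is_arg_min_expected_least_squares:
  fixes A :: "real^'p^'n" and Y :: "'w \<Rightarrow> real^'n"
  assumes inv: "invertible (transpose A ** A)" and "prob_space M"
    and int: "\<And>i. integrable M (\<lambda>\<omega>. Y \<omega> $ i)" "\<And>i. integrable M (\<lambda>\<omega>. (Y \<omega> $ i)\<^sup>2)"
    and mean: "\<And>i. (\<integral>\<omega>. Y \<omega> $ i \<partial>M) = m $ i"
  shows "is_arg_min (\<lambda>\<beta>. \<integral>\<omega>. (norm (Y \<omega> - A *v \<beta>))\<^sup>2 \<partial>M) (\<lambda>_. True) \<beta> \<longleftrightarrow> \<beta> = least_squares A m"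
proof (rule is_arg_min_plus_norm[OF inv])
  interpret prob_space M by fact
  fix \<beta>
  have sq: "(norm (y - z))\<^sup>2 = (\<Sum>i\<in>UNIV. (y $ i)\<^sup>2 - 2 * (y $ i) * z $ i + (z $ i)\<^sup>2)" for y z :: "real^'n"
    unfolding power2_norm_eq_inner inner_vec_def by (simp add: power2_eq_square algebra_simps)
  have risk: "(\<integral>\<omega>. (norm (Y \<omega> - z))\<^sup>2 \<partial>M) = (\<Sum>i\<in>UNIV. (\<integral>\<omega>. (Y \<omega> $ i)\<^sup>2 \<partial>M) - (m $ i)\<^sup>2) + (norm (m - z))\<^sup>2"
    for z
  proof -
    have "(\<integral>\<omega>. (norm (Y \<omega> - z))\<^sup>2 \<partial>M) =
      (\<Sum>i\<in>UNIV. (\<integral>\<omega>. (Y \<omega> $ i)\<^sup>2 \<partial>M) - 2 * (m $ i) * z $ i + (z $ i)\<^sup>2)"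
      unfolding sq using int by (simp add: mean prob_space)
    then show ?thesis by (simp add: sq sum.distrib sum_subtractf)
  qed
  show "(\<integral>\<omega>. (norm (Y \<omega> - A *v \<beta>))\<^sup>2 \<partial>M) = (\<integral>\<omega>. (norm (Y \<omega> - A *v least_squares A m))\<^sup>2 \<partial>M) +
      (norm (A *v (\<beta> - least_squares A m)))\<^sup>2"
    using least_squares_pythagoras[OF inv, of m \<beta>] by (simp add: risk)
qed

text \<open>Cramer's rule exhibits the solution as a measurable function of the matrix.\<close>

definition cramer_solution :: "real^'n^'n \<Rightarrow> real^'n \<Rightarrow> real^'n" where
  "cramer_solution B u = (\<chi> k. det (\<chi> i j. if j = k then u $ i else B $ i $ j) / det B)"

lemma cramer_solution:
  assumes "invertible B"
  shows "B *v cramer_solution B u = u"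
  using cramer[of B "cramer_solution B u" u] assms
  by (simp add: cramer_solution_def invertible_det_nz)

lemma borel_measurable_det:
  assumes "\<And>i j. (\<lambda>v. B v $ i $ j) \<in> borel_measurable M"
  shows "(\<lambda>v. det (B v :: real^'n^'n)) \<in> borel_measurable M"
  unfolding det_def using assms by measurable

lemma borel_measurable_vec:
  fixes f :: "'a \<Rightarrow> real^'n"
  assumes "\<And>i. (\<lambda>v. f v $ i) \<in> borel_measurable M"
  shows "f \<in> borel_measurable M"
  using assms by (subst borel_measurable_euclidean_space) (auto simp: Basis_vec_def inner_axis)

lemma borel_measurable_cramer_solution:
  assumes [measurable]: "\<And>i j. (\<lambda>v. B v $ i $ j) \<in> borel_measurable M" "\<And>i. (\<lambda>v. u v $ i) \<in> borel_measurable M"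
  shows "(\<lambda>v. cramer_solution (B v) (u v) $ k) \<in> borel_measurable M"
  unfolding cramer_solution_def vec_lambda_beta
  by (intro borel_measurable_divide borel_measurable_det) (auto simp: if_distrib)

text \<open>For an invertible Gram matrix this is A (A^T A)^{-1} u, the vector that represents the
  fit as a linear functional of the response. The Cramer form keeps it a Borel function of the
  matrix; where the determinant is zero, division by zero gives the zero vector.\<close>

definition fit_weights :: "real^'p^'n \<Rightarrow> real^'p \<Rightarrow> real^'n" where
  "fit_weights A u = A *v cramer_solution (transpose A ** A) u"

text \<open>Write \<open>u\<close> as the Gram matrix applied to the Cramer solution, move the
  symmetric Gram matrix to the other factor, and use the normal equation.\<close>

lemma inner_least_squares:
  fixes A :: "real^'p^'n"
  assumes "invertible (transpose A ** A)"
  shows "u \<bullet> least_squares A y = fit_weights A u \<bullet> y"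
proof -
  let ?w = "cramer_solution (transpose A ** A) u"
  have "u \<bullet> least_squares A y = ((transpose A ** A) *v ?w) \<bullet> least_squares A y"
    by (simp add: cramer_solution[OF assms])
  also have "\<dots> = ?w \<bullet> ((transpose A ** A) *v least_squares A y)"
    by (simp add: inner_gram inner_commute[of "_ *v _" "least_squares A y"]) (simp add: inner_commute)
  also have "\<dots> = ?w \<bullet> (transpose A *v y)"
    by (simp add: least_squares_normal_equation[OF assms])
  finally show ?thesis
    by (simp only: fit_weights_def inner_transpose_vector)
qed

text \<open>The sandwich product applied to \<open>u\<close> is the least squares solution for the
  response \<open>S *v fit_weights A u\<close>, so \<open>inner_least_squares\<close> closes the gap
  without a separate proof that the inverse Gram matrix is symmetric.\<close>

lemma fit_variance_eq:
  fixes A :: "real^'p^'n"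
  assumes "invertible (transpose A ** A)"
  shows "fit_variance \<tau> S A u = (1 + 1 / \<tau>\<^sup>2) * (fit_weights A u \<bullet> (S *v fit_weights A u))"
proof -
  have "fit_weights A u = A *v (matrix_inv (transpose A ** A) *v u)"
    unfolding fit_weights_def
    by (subst (2) cramer_solution[OF assms, of u, symmetric]) (simp add: matrix_inv_mult_cancel[OF assms])
  then have "fit_variance \<tau> S A u = (1 + 1 / \<tau>\<^sup>2) * (u \<bullet> least_squares A (S *v fit_weights A u))"
    by (simp add: fit_variance_def least_squares_def matrix_vector_mul_assoc matrix_mul_assoc)
  then show ?thesis by (simp add: inner_least_squares[OF assms])
qed

section \<open>Gaussian vectors\<close>

lemma covariance_matrix_nonneg: "covariance_matrix S \<Longrightarrow> 0 \<le> c \<bullet> (S *v c)"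
  by (simp add: covariance_matrix_def)

lemma covariance_matrix_inner_commute:
  assumes "covariance_matrix S"
  shows "s \<bullet> (S *v t) = t \<bullet> (S *v s)"
  using assms inner_transpose_vector[of s S t] by (simp add: covariance_matrix_def inner_commute)

lemma quadratic_form_add:
  assumes "covariance_matrix S"
  shows "(s + t) \<bullet> (S *v (s + t)) = s \<bullet> (S *v s) + 2 * (s \<bullet> (S *v t)) + t \<bullet> (S *v t)"
  using covariance_matrix_inner_commute[OF assms, of t s]
  by (simp add: matrix_vector_right_distrib inner_add_left inner_add_right)

lemma quadratic_form_scaleR:
  fixes S :: "real^'n^'n"
  shows "(r *\<^sub>R s) \<bullet> (S *v (r *\<^sub>R s)) = r\<^sup>2 * (s \<bullet> (S *v s))"
  by (simp add: matrix_vector_mult_scaleR power2_eq_square)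

lemma multivariate_normal_measurable: "multivariate_normal M X m S \<Longrightarrow> X \<in> borel_measurable M"
  by (simp add: multivariate_normal_def)

lemma multivariate_normal_translate:
  assumes S: "covariance_matrix S" and X: "multivariate_normal M X 0 S"
  shows "multivariate_normal M (\<lambda>\<omega>. m + X \<omega>) m S"
  unfolding multivariate_normal_def
proof (intro conjI allI)
  have [measurable]: "X \<in> borel_measurable M"
    using X by (rule multivariate_normal_measurable)
  show "(\<lambda>\<omega>. m + X \<omega>) \<in> borel_measurable M" by measurable
  fix c
  let ?v = "c \<bullet> (S *v c)"
  have "distr M borel (\<lambda>\<omega>. c \<bullet> (m + X \<omega>)) = distr (distr M borel (\<lambda>\<omega>. c \<bullet> X \<omega>)) borel (\<lambda>y. c \<bullet> m + y)"
    by (subst distr_distr) (auto simp: comp_def inner_add_right)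
  also have "\<dots> = distr (normal_law 0 ?v) borel (\<lambda>y. c \<bullet> m + y)"
    using X by (simp add: multivariate_normal_def)
  also have "\<dots> = normal_law (c \<bullet> m) ?v"
    unfolding normal_law_eq_distr[OF covariance_matrix_nonneg[OF S]]
    by (subst distr_distr) (auto simp: comp_def)
  finally show "distr M borel (\<lambda>\<omega>. c \<bullet> (m + X \<omega>)) = normal_law (c \<bullet> m) ?v" .
qed

text \<open>The joint characteristic function at \<open>t\<close> is that of the scalar
  \<open>t \<bullet> X\<close> at 1. The converse below uses that the scalar
  \<open>c \<bullet> X\<close> at \<open>s\<close> is the joint one at
  \<open>s *\<^sub>R c\<close>.\<close>

lemma multivariate_normal_char:
  assumes S: "covariance_matrix S" and X: "multivariate_normal M X m S"
  shows "(\<integral>\<omega>. cis (t \<bullet> X \<omega>) \<partial>M) = cis (t \<bullet> m) * exp (- (t \<bullet> (S *v t)) / 2)"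
proof -
  have [measurable]: "X \<in> borel_measurable M"
    using X by (rule multivariate_normal_measurable)
  have "(\<integral>\<omega>. cis (t \<bullet> X \<omega>) \<partial>M) = char (distr M borel (\<lambda>\<omega>. t \<bullet> X \<omega>)) 1"
    unfolding char_def by (subst integral_distr) (auto simp: cis_conv_exp)
  also have "\<dots> = char (normal_law (t \<bullet> m) (t \<bullet> (S *v t))) 1"
    using X by (simp add: multivariate_normal_def)
  finally show ?thesis
    using covariance_matrix_nonneg[OF S] by (simp add: char_normal_law)
qed

lemma (in prob_space) multivariate_normal_charI:
  assumes S: "covariance_matrix S" and X[measurable]: "X \<in> borel_measurable M"
    and eq: "\<And>t. (\<integral>\<omega>. cis (t \<bullet> X \<omega>) \<partial>M) = cis (t \<bullet> m) * exp (- (t \<bullet> (S *v t)) / 2)"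
  shows "multivariate_normal M X m S"
  unfolding multivariate_normal_def
proof (intro conjI allI X Levy_uniqueness ext)
  fix c :: "real^'b" and s
  have v: "0 \<le> c \<bullet> (S *v c)" using S by (rule covariance_matrix_nonneg)
  show "real_distribution (distr M borel (\<lambda>\<omega>. c \<bullet> X \<omega>))" by simp
  show "real_distribution (normal_law (c \<bullet> m) (c \<bullet> (S *v c)))"
    using v by (rule real_distribution_normal_law)
  have "char (distr M borel (\<lambda>\<omega>. c \<bullet> X \<omega>)) s = (\<integral>\<omega>. cis ((s *\<^sub>R c) \<bullet> X \<omega>) \<partial>M)"
    unfolding char_def by (subst integral_distr) (auto simp: cis_conv_exp)
  then show "char (distr M borel (\<lambda>\<omega>. c \<bullet> X \<omega>)) s = char (normal_law (c \<bullet> m) (c \<bullet> (S *v c))) s"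
    unfolding eq char_normal_law[OF v] quadratic_form_scaleR by simp
qed

text \<open>Kac's theorem: the factorisation says that the law of the pair and the product of the
  marginals have the same characteristic function at (s, t), and the product space is again
  Euclidean.\<close>

lemma (in prob_space) indep_var_charI:
  fixes V G :: "'a \<Rightarrow> 'v::euclidean_space"
  assumes [measurable]: "V \<in> borel_measurable M" "G \<in> borel_measurable M"
    and eq: "\<And>s t. (\<integral>\<omega>. cis (s \<bullet> V \<omega> + t \<bullet> G \<omega>) \<partial>M) =
      (\<integral>\<omega>. cis (s \<bullet> V \<omega>) \<partial>M) * (\<integral>\<omega>. cis (t \<bullet> G \<omega>) \<partial>M)"
  shows "indep_var borel V borel G"
  unfolding indep_var_distribution_eq
proof (intro conjI assms(1,2))
  interpret V: prob_space "distr M borel V" by (rule prob_space_distr) simp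
  interpret G: prob_space "distr M borel G" by (rule prob_space_distr) simp
  interpret VG: pair_prob_space "distr M borel V" "distr M borel G" ..
  show "distr M borel V \<Otimes>\<^sub>M distr M borel G = distr M (borel \<Otimes>\<^sub>M borel) (\<lambda>\<omega>. (V \<omega>, G \<omega>))"
  proof (rule Levy_uniqueness_euclidean)
    show "prob_space (distr M borel V \<Otimes>\<^sub>M distr M borel G)"
      by (rule VG.P.prob_space_axioms)
    show "prob_space (distr M (borel \<Otimes>\<^sub>M borel) (\<lambda>\<omega>. (V \<omega>, G \<omega>)))"
      by (rule prob_space_distr) simp
    show s: "sets (distr M borel V \<Otimes>\<^sub>M distr M borel G) = sets borel"
      unfolding borel_prod[symmetric] by (intro sets_pair_measure_cong) simp_all
    show "sets (distr M (borel \<Otimes>\<^sub>M borel) (\<lambda>\<omega>. (V \<omega>, G \<omega>))) = sets borel"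
      by (simp add: borel_prod)
    fix p :: "'v \<times> 'v"
    have int: "integrable (distr M borel V \<Otimes>\<^sub>M distr M borel G) (\<lambda>x. cis (p \<bullet> x))"
    proof (rule VG.integrable_const_bound[of _ 1])
      show "(\<lambda>x. cis (p \<bullet> x)) \<in> borel_measurable (distr M borel V \<Otimes>\<^sub>M distr M borel G)"
        unfolding measurable_cong_sets[OF s refl] by measurable
    qed simp
    have "(\<integral>x. cis (p \<bullet> x) \<partial>(distr M borel V \<Otimes>\<^sub>M distr M borel G)) =
      (\<integral>v. (\<integral>g. cis (p \<bullet> (v, g)) \<partial>distr M borel G) \<partial>distr M borel V)"
      using VG.integral_fst'[OF int] by simp
    also have "\<dots> = (\<integral>v. cis (fst p \<bullet> v) * (\<integral>g. cis (snd p \<bullet> g) \<partial>distr M borel G) \<partial>distr M borel V)"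
      by (simp add: inner_prod_def cis_mult[symmetric])
    also have "\<dots> = (\<integral>\<omega>. cis (fst p \<bullet> V \<omega>) \<partial>M) * (\<integral>\<omega>. cis (snd p \<bullet> G \<omega>) \<partial>M)"
      by (simp add: integral_distr)
    also have "\<dots> = (\<integral>\<omega>. cis (p \<bullet> (V \<omega>, G \<omega>)) \<partial>M)"
      unfolding eq[symmetric] by (simp add: inner_prod_def)
    also have "\<dots> = (\<integral>x. cis (p \<bullet> x) \<partial>distr M (borel \<Otimes>\<^sub>M borel) (\<lambda>\<omega>. (V \<omega>, G \<omega>)))"
      by (subst integral_distr) (auto simp: borel_prod)
    finally show "(\<integral>x. cis (p \<bullet> x) \<partial>(distr M borel V \<Otimes>\<^sub>M distr M borel G)) =
      (\<integral>x. cis (p \<bullet> x) \<partial>distr M (borel \<Otimes>\<^sub>M borel) (\<lambda>\<omega>. (V \<omega>, G \<omega>)))" .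
  qed
qed

text \<open>The cross terms in the exponent cancel: the covariance of \<open>Y + \<tau> Z\<close> and \<open>Y - Z / \<tau>\<close>
  is \<open>S - (\<tau> / \<tau>) S = 0\<close>.\<close>

lemma (in prob_space) gaussian_fission:
  fixes Y Z :: "'a \<Rightarrow> real^'n"
  assumes S: "covariance_matrix S" and Y: "multivariate_normal M Y m S"
    and Z: "multivariate_normal M Z 0 S" and ind: "indep_var borel Y borel Z" and \<tau>: "0 < \<tau>"
  defines "V \<equiv> \<lambda>\<omega>. Y \<omega> + \<tau> *\<^sub>R Z \<omega>" and "G \<equiv> \<lambda>\<omega>. Y \<omega> - (1 / \<tau>) *\<^sub>R Z \<omega>"
  shows "indep_var borel V borel G"
    and "multivariate_normal M G m ((1 + 1 / \<tau>\<^sup>2) *\<^sub>R S)"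
proof -
  have [measurable]: "Y \<in> borel_measurable M" "Z \<in> borel_measurable M"
    using Y Z by (auto intro: multivariate_normal_measurable)
  have VG[measurable]: "V \<in> borel_measurable M" "G \<in> borel_measurable M"
    unfolding V_def G_def by measurable
  let ?Q = "\<lambda>s. s \<bullet> (S *v s)"
  \<comment> \<open>This one formula gives both claims: s = 0 or t = 0 yields the marginal
    characteristic functions, whose product it is.\<close>
  have joint: "(\<integral>\<omega>. cis (s \<bullet> V \<omega> + t \<bullet> G \<omega>) \<partial>M) =
      (cis (s \<bullet> m) * exp (- ((1 + \<tau>\<^sup>2) * ?Q s) / 2)) * (cis (t \<bullet> m) * exp (- ((1 + 1 / \<tau>\<^sup>2) * ?Q t) / 2))"
    for s t
  proof -
    \<comment> \<open>The coefficient of \<open>Z\<close> once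
      \<open>s \<bullet> V + t \<bullet> G\<close> is sorted by the independent vectors
      \<open>Y\<close> and \<open>Z\<close>; that of \<open>Y\<close> is
      \<open>s + t\<close>.\<close>
    let ?r = "\<tau> *\<^sub>R s + (- 1 / \<tau>) *\<^sub>R t"
    have "indep_var borel ((\<lambda>y. cis ((s + t) \<bullet> y)) \<circ> Y) borel ((\<lambda>z. cis (?r \<bullet> z)) \<circ> Z)"
      by (rule indep_var_compose[OF ind]) measurable
    then have ind': "indep_var borel (\<lambda>\<omega>. cis ((s + t) \<bullet> Y \<omega>)) borel (\<lambda>\<omega>. cis (?r \<bullet> Z \<omega>))"
      by (simp add: comp_def)
    have int: "integrable M (\<lambda>\<omega>. cis (u \<bullet> X \<omega>))" if [measurable]: "X \<in> borel_measurable M"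
      for u and X :: "'a \<Rightarrow> real^'n"
      by (rule integrable_const_bound[of _ 1]) auto
    have arg: "s \<bullet> V \<omega> + t \<bullet> G \<omega> = (s + t) \<bullet> Y \<omega> + ?r \<bullet> Z \<omega>" for \<omega>
      by (simp add: V_def G_def inner_add_left inner_diff_left inner_add_right inner_diff_right)
    have "(\<integral>\<omega>. cis (s \<bullet> V \<omega> + t \<bullet> G \<omega>) \<partial>M) = (\<integral>\<omega>. cis ((s + t) \<bullet> Y \<omega>) * cis (?r \<bullet> Z \<omega>) \<partial>M)"
      unfolding arg cis_mult[symmetric] ..
    also have "\<dots> = (\<integral>\<omega>. cis ((s + t) \<bullet> Y \<omega>) \<partial>M) * (\<integral>\<omega>. cis (?r \<bullet> Z \<omega>) \<partial>M)"
      by (rule indep_var_lebesgue_integral[OF ind']) (simp_all add: int)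
    also have "\<dots> = cis ((s + t) \<bullet> m) * exp (- ?Q (s + t) / 2) * exp (- ?Q ?r / 2)"
      by (simp add: multivariate_normal_char[OF S Y] multivariate_normal_char[OF S Z])
    also have "\<dots> = cis ((s + t) \<bullet> m) * exp (- (?Q (s + t) + ?Q ?r) / 2)"
      by (simp add: exp_add[symmetric] add_divide_distrib diff_divide_distrib flip: of_real_mult)
    also have "?Q (s + t) + ?Q ?r = (1 + \<tau>\<^sup>2) * ?Q s + (1 + 1 / \<tau>\<^sup>2) * ?Q t"
    proof -
      have "(\<tau> *\<^sub>R s) \<bullet> (S *v ((- 1 / \<tau>) *\<^sub>R t)) = - (s \<bullet> (S *v t))"
        using \<tau> by (simp only: matrix_vector_mult_scaleR inner_scaleR_left inner_scaleR_right) simp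
      then show ?thesis
        unfolding quadratic_form_add[OF S] quadratic_form_scaleR
        by (simp add: algebra_simps power_divide)
    qed
    also have "cis ((s + t) \<bullet> m) = cis (s \<bullet> m) * cis (t \<bullet> m)"
      by (simp add: inner_add_left cis_mult)
    also have "exp (- ((1 + \<tau>\<^sup>2) * ?Q s + (1 + 1 / \<tau>\<^sup>2) * ?Q t) / 2) =
        exp (- ((1 + \<tau>\<^sup>2) * ?Q s) / 2) * exp (- ((1 + 1 / \<tau>\<^sup>2) * ?Q t) / 2)"
      by (simp only: exp_add[symmetric] minus_add_distrib add_divide_distrib)
    finally show ?thesis by simp
  qed
  show "indep_var borel V borel G"
  proof (rule indep_var_charI[OF VG])
    fix s t
    show "(\<integral>\<omega>. cis (s \<bullet> V \<omega> + t \<bullet> G \<omega>) \<partial>M) = (\<integral>\<omega>. cis (s \<bullet> V \<omega>) \<partial>M) * (\<integral>\<omega>. cis (t \<bullet> G \<omega>) \<partial>M)"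
      using joint[of s t] joint[of s 0] joint[of 0 t] by simp
  qed
  have Q: "t \<bullet> (((1 + 1 / \<tau>\<^sup>2) *\<^sub>R S) *v t) = (1 + 1 / \<tau>\<^sup>2) * ?Q t" for t
    by (simp add: scaleR_matrix_vector_assoc[symmetric])
  show "multivariate_normal M G m ((1 + 1 / \<tau>\<^sup>2) *\<^sub>R S)"
  proof (rule multivariate_normal_charI[OF _ VG(2)])
    have "transpose ((1 + 1 / \<tau>\<^sup>2) *\<^sub>R S) = (1 + 1 / \<tau>\<^sup>2) *\<^sub>R transpose S"
      by (simp add: transpose_def vec_eq_iff)
    then show "covariance_matrix ((1 + 1 / \<tau>\<^sup>2) *\<^sub>R S)"
      using S unfolding covariance_matrix_def Q by simp
    show "(\<integral>\<omega>. cis (t \<bullet> G \<omega>) \<partial>M) =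
      cis (t \<bullet> m) * exp (- (t \<bullet> (((1 + 1 / \<tau>\<^sup>2) *\<^sub>R S) *v t)) / 2)" for t
      using joint[of 0 t] by (simp only: Q) simp
  qed
qed

lemma (in prob_space) cond_distributed_linear:
  fixes V G :: "'a \<Rightarrow> real^'n"
  assumes ind: "indep_var borel V borel G" and G: "multivariate_normal M G m S"
    and c[measurable]: "c \<in> borel_measurable borel"
    and U: "\<And>\<omega>. \<omega> \<in> space M \<Longrightarrow> U \<omega> = c (V \<omega>) \<bullet> G \<omega>"
    and K: "\<And>\<omega>. \<omega> \<in> space M \<Longrightarrow> K \<omega> = normal_law (c (V \<omega>) \<bullet> m) (c (V \<omega>) \<bullet> (S *v c (V \<omega>)))"
  shows "cond_distributed M V U K"
  unfolding cond_distributed_def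
proof (intro conjI ballI)
  have V_meas[measurable]: "V \<in> borel_measurable M" and G_meas[measurable]: "G \<in> borel_measurable M"
    using ind by (auto simp: indep_var_distribution_eq)
  show "V \<in> borel_measurable M" by simp
  show "U \<in> borel_measurable M"
    by (subst measurable_cong[OF U]) auto
  \<comment> \<open>As the image of a fixed law under a map depending measurably on
    \<open>v\<close>, the normal law is visibly a kernel; its definition by cases on the variance
    would hide this.\<close>
  have law: "normal_law (u \<bullet> m) (u \<bullet> (S *v u)) = distr (distr M borel G) borel (\<lambda>g. u \<bullet> g)" for u
    using G by (subst distr_distr) (auto simp: comp_def multivariate_normal_def)
  have "(\<lambda>v. distr (distr M borel G) borel (\<lambda>g. c v \<bullet> g)) \<in> borel \<rightarrow>\<^sub>M prob_algebra borel"
  proof (rule measurable_distr_prob_space2[where M = borel])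
    show "(\<lambda>v. distr M borel G) \<in> borel \<rightarrow>\<^sub>M prob_algebra borel"
      by (rule measurable_const) (simp add: space_prob_algebra prob_space_distr)
  qed measurable
  from measurable_generated_by[OF this, where M = M and V = V]
  show "K \<in> generated_by M V \<rightarrow>\<^sub>M prob_algebra borel"
    by (subst measurable_cong[OF K[unfolded law]]) (simp_all add: law)
  fix B :: "real set" assume B[measurable]: "B \<in> sets borel"
  have "{p. c (fst p) \<bullet> snd p \<in> B} = (\<lambda>p. c (fst p) \<bullet> snd p) -` B \<inter> space (borel \<Otimes>\<^sub>M borel)"
    by (auto simp: space_pair_measure)
  also have "\<dots> \<in> sets (borel \<Otimes>\<^sub>M borel)" by measurable
  finally have D: "{p. c (fst p) \<bullet> snd p \<in> B} \<in> sets (borel \<Otimes>\<^sub>M borel)" .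
  have eq: "{\<omega>' \<in> space M. (V \<omega>', G \<omega>') \<in> {p. c (fst p) \<bullet> snd p \<in> B}} = {\<omega>' \<in> space M. U \<omega>' \<in> B}"
    by (auto simp: U)
  show "AE \<omega> in M. cond_prob_given M V {\<omega>' \<in> space M. U \<omega>' \<in> B} \<omega> = measure (K \<omega>) B"
    using cond_prob_given_indep[OF ind D] AE_space unfolding eq
    by eventually_elim (simp add: K law measure_distr vimage_def)
qed

text \<open>The interval moves with \<open>V\<close>, so the event is not of the form
  \<open>U \<in> B\<close> for a fixed \<open>B\<close> and does not follow directly from
  \<open>cond_distributed_linear\<close>; it is treated as a set of pairs (V, G).\<close>

lemma (in prob_space) cond_prob_central_interval:
  fixes V G :: "'a \<Rightarrow> real^'n"
  assumes ind: "indep_var borel V borel G" and G: "multivariate_normal M G m S"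
    and S: "covariance_matrix S"
    and c[measurable]: "c \<in> borel_measurable borel" and q: "0 < q" "q < 1 / 2"
  shows "AE \<omega> in M. cond_prob_given M V {\<omega>' \<in> space M.
      \<bar>c (V \<omega>') \<bullet> G \<omega>' - c (V \<omega>') \<bullet> m\<bar> \<le> std_normal_upper_quantile q * sqrt (c (V \<omega>') \<bullet> (S *v c (V \<omega>')))} \<omega>
    = (if c (V \<omega>) \<bullet> (S *v c (V \<omega>)) = 0 then 1 else 1 - 2 * q)"
proof -
  have V_meas[measurable]: "V \<in> borel_measurable M" and G_meas[measurable]: "G \<in> borel_measurable M"
    using ind by (auto simp: indep_var_distribution_eq)
  have [measurable]: "(\<lambda>u. S *v u) \<in> borel_measurable borel"
    by (intro borel_measurable_continuous_onI matrix_vector_mult_linear_continuous_on)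
  let ?h = "\<lambda>u. std_normal_upper_quantile q * sqrt (u \<bullet> (S *v u))"
  let ?D = "{p. \<bar>c (fst p) \<bullet> snd p - c (fst p) \<bullet> m\<bar> \<le> ?h (c (fst p))}"
  have "?D = {p \<in> space (borel \<Otimes>\<^sub>M borel). \<bar>c (fst p) \<bullet> snd p - c (fst p) \<bullet> m\<bar> \<le> ?h (c (fst p))}"
    by (auto simp: space_pair_measure)
  also have "\<dots> \<in> sets (borel \<Otimes>\<^sub>M borel)" by measurable
  finally have D: "?D \<in> sets (borel \<Otimes>\<^sub>M borel)" .
  have frozen: "measure (distr M borel G) {g. \<bar>u \<bullet> g - u \<bullet> m\<bar> \<le> ?h u} =
      (if u \<bullet> (S *v u) = 0 then 1 else 1 - 2 * q)" for u
  proof -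
    have "{g. \<bar>u \<bullet> g - u \<bullet> m\<bar> \<le> ?h u} = (\<lambda>g. u \<bullet> g) -` {u \<bullet> m - ?h u..u \<bullet> m + ?h u}"
      by (auto simp: abs_le_iff)
    then have "measure (distr M borel G) {g. \<bar>u \<bullet> g - u \<bullet> m\<bar> \<le> ?h u} =
      measure (distr (distr M borel G) borel (\<lambda>g. u \<bullet> g)) {u \<bullet> m - ?h u..u \<bullet> m + ?h u}"
      by (subst measure_distr) auto
    also have "distr (distr M borel G) borel (\<lambda>g. u \<bullet> g) = normal_law (u \<bullet> m) (u \<bullet> (S *v u))"
      using G by (subst distr_distr) (auto simp: comp_def multivariate_normal_def)
    finally show ?thesis
      by (simp only: normal_law_central_interval[OF q covariance_matrix_nonneg[OF S]])
  qed
  show ?thesis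
    using cond_prob_given_indep[OF ind D] by (simp add: frozen)
qed

theorem corollary1:
  fixes M :: "'w measure"
    and x :: "'n::finite \<Rightarrow> 'x"
    and f0 :: "'x \<Rightarrow> real"
    and \<epsilon> Z :: "'w \<Rightarrow> real^'n"
    and S :: "real^'n^'n"
    and a :: "real^'n \<Rightarrow> 'p::finite \<Rightarrow> 'x \<Rightarrow> real"
    and \<tau> \<alpha> :: real
    and Y fY gY :: "'w \<Rightarrow> real^'n"
    and A :: "'w \<Rightarrow> real^'p^'n"
    and mu_hat mu_star var :: "'n \<Rightarrow> 'w \<Rightarrow> real"
  defines "Y \<equiv> \<lambda>\<omega>. \<chi> i. f0 (x i) + \<epsilon> \<omega> $ i"
    and "fY \<equiv> \<lambda>\<omega>. Y \<omega> + \<tau> *\<^sub>R Z \<omega>"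
    and "gY \<equiv> \<lambda>\<omega>. Y \<omega> - (1 / \<tau>) *\<^sub>R Z \<omega>"
    and "A \<equiv> \<lambda>\<omega>. design_matrix x (a (fY \<omega>))"
    and "mu_hat \<equiv> \<lambda>i \<omega>. basis_vec (a (fY \<omega>)) (x i) \<bullet> beta_hat (A \<omega>) (gY \<omega>)"
    and "mu_star \<equiv> \<lambda>i \<omega>. basis_vec (a (fY \<omega>)) (x i) \<bullet> beta_star M Y (A \<omega>)"
    and "var \<equiv> \<lambda>i \<omega>. fit_variance \<tau> S (A \<omega>) (basis_vec (a (fY \<omega>)) (x i))"
  assumes "prob_space M"
    and "covariance_matrix S"
    and "multivariate_normal M \<epsilon> 0 S"
    and "multivariate_normal M Z 0 S"
    and "prob_space.indep_var M borel Y borel Z"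
    and "0 < \<tau>"
    and "0 < \<alpha>" and "\<alpha> < 1"
    and "\<And>i j. (\<lambda>v. a v j (x i)) \<in> borel_measurable borel"
    and "\<And>\<omega>. \<omega> \<in> space M \<Longrightarrow> invertible (transpose (A \<omega>) ** A \<omega>)"
  shows "(\<forall>\<omega>\<in>space M.
            (\<forall>\<beta>. is_arg_min (\<lambda>\<beta>. (norm (gY \<omega> - A \<omega> *v \<beta>))\<^sup>2) (\<lambda>_. True) \<beta>
                  \<longleftrightarrow> \<beta> = least_squares (A \<omega>) (gY \<omega>)) \<and>
            (\<forall>\<beta>. is_arg_min (\<lambda>\<beta>. integral\<^sup>L M (\<lambda>\<omega>'. (norm (Y \<omega>' - A \<omega> *v \<beta>))\<^sup>2)) (\<lambda>_. True) \<beta>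
                  \<longleftrightarrow> \<beta> = least_squares (A \<omega>) (\<chi> i. f0 (x i))) \<and>
            beta_hat (A \<omega>) (gY \<omega>) = least_squares (A \<omega>) (gY \<omega>) \<and>
            beta_star M Y (A \<omega>) = least_squares (A \<omega>) (\<chi> i. f0 (x i)))
    \<and> (\<forall>i. cond_distributed M fY (mu_hat i) (\<lambda>\<omega>. normal_law (mu_star i \<omega>) (var i \<omega>)))
    \<and> (\<forall>i. AE \<omega> in M.
          let h = (\<lambda>\<omega>'. std_normal_upper_quantile (\<alpha> / 2) * sqrt (var i \<omega>'));
              coverage = cond_prob_given M fY
                {\<omega>' \<in> space M. mu_star i \<omega>' \<in> {mu_hat i \<omega>' - h \<omega>' .. mu_hat i \<omega>' + h \<omega>'}} \<omega>
          in 1 - \<alpha> \<le> coverage \<and> (var i \<omega> \<noteq> 0 \<longrightarrow> coverage = 1 - \<alpha>))"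
proof -
  interpret prob_space M by fact
  note S = \<open>covariance_matrix S\<close>
    and inv = \<open>\<And>\<omega>. \<omega> \<in> space M \<Longrightarrow> invertible (transpose (A \<omega>) ** A \<omega>)\<close>
    and a[measurable] = \<open>\<And>i j. (\<lambda>v. a v j (x i)) \<in> borel_measurable borel\<close>
  define m :: "real^'n" where "m = (\<chi> i. f0 (x i))"
  define S' where "S' = (1 + 1 / \<tau>\<^sup>2) *\<^sub>R S"
  \<comment> \<open>Design matrix and weights are defined on all values \<open>v\<close> of
    \<open>fY\<close>, not on outcomes, so that the weights can be shown to be Borel on the whole
    space.\<close>
  define D where "D v = design_matrix x (a v)" for v
  define c where "c i v = fit_weights (D v) (basis_vec (a v) (x i))" for i v
  have Y_eq: "Y = (\<lambda>\<omega>. m + \<epsilon> \<omega>)"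
    by (simp add: Y_def m_def vec_eq_iff fun_eq_iff)
  have A_eq: "A \<omega> = D (fY \<omega>)" for \<omega> by (simp add: A_def D_def)
  have Y: "multivariate_normal M Y m S"
    unfolding Y_eq by (rule multivariate_normal_translate) fact+
  have Y_meas[measurable]: "Y \<in> borel_measurable M"
    using Y by (rule multivariate_normal_measurable)
  have fission: "indep_var borel fY borel gY" "multivariate_normal M gY m S'"
    unfolding fY_def gY_def S'_def
    by (rule gaussian_fission[OF S Y \<open>multivariate_normal M Z 0 S\<close> \<open>indep_var borel Y borel Z\<close> \<open>0 < \<tau>\<close>])+
  have quad: "u \<bullet> (S' *v u) = (1 + 1 / \<tau>\<^sup>2) * (u \<bullet> (S *v u))" for u
    by (simp add: S'_def scaleR_matrix_vector_assoc[symmetric])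
  have S': "covariance_matrix S'"
  proof -
    have "transpose S' = (1 + 1 / \<tau>\<^sup>2) *\<^sub>R transpose S"
      by (simp add: S'_def transpose_def vec_eq_iff)
    then show ?thesis
      using S unfolding covariance_matrix_def quad by (simp add: S'_def)
  qed

  have coord: "integrable M (\<lambda>\<omega>. Y \<omega> $ i)" "integrable M (\<lambda>\<omega>. (Y \<omega> $ i)\<^sup>2)"
      "(\<integral>\<omega>. Y \<omega> $ i \<partial>M) = m $ i" for i
  proof -
    \<comment> \<open>The linear functional given by \<open>axis i 1\<close> extracts the
      coordinate.\<close>
    obtain v where v: "0 \<le> v" and law: "distr M borel (\<lambda>\<omega>. Y \<omega> $ i) = normal_law (m $ i) v"
      using Y covariance_matrix_nonneg[OF S, of "axis i 1"]
      by (auto simp: multivariate_normal_def inner_axis' dest: spec[of _ "axis i 1"])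
    have [measurable]: "(\<lambda>\<omega>. Y \<omega> $ i) \<in> borel_measurable M"
      by (simp add: cart_eq_inner_axis)
    note mom = normal_law_moments[OF v, of "m $ i", folded law]
    show "integrable M (\<lambda>\<omega>. Y \<omega> $ i)" using mom(1) by (simp add: integrable_distr_eq)
    show "integrable M (\<lambda>\<omega>. (Y \<omega> $ i)\<^sup>2)" using mom(3) by (simp add: integrable_distr_eq)
    show "(\<integral>\<omega>. Y \<omega> $ i \<partial>M) = m $ i" using mom(2) by (simp add: integral_distr)
  qed
  have min_hat: "is_arg_min (\<lambda>\<beta>. (norm (gY \<omega> - A \<omega> *v \<beta>))\<^sup>2) (\<lambda>_. True) \<beta> \<longleftrightarrow>
      \<beta> = least_squares (A \<omega>) (gY \<omega>)" if "\<omega> \<in> space M" for \<omega> \<beta>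
    by (rule is_arg_min_least_squares[OF inv[OF that]])
  have min_star: "is_arg_min (\<lambda>\<beta>. integral\<^sup>L M (\<lambda>\<omega>'. (norm (Y \<omega>' - A \<omega> *v \<beta>))\<^sup>2)) (\<lambda>_. True) \<beta> \<longleftrightarrow>
      \<beta> = least_squares (A \<omega>) m" if "\<omega> \<in> space M" for \<omega> \<beta>
    by (rule is_arg_min_expected_least_squares[OF inv[OF that] prob_space_axioms coord])
  have hat: "beta_hat (A \<omega>) (gY \<omega>) = least_squares (A \<omega>) (gY \<omega>)" if "\<omega> \<in> space M" for \<omega>
    unfolding beta_hat_def by (rule arg_min_eqI) (rule min_hat[OF that])
  have star: "beta_star M Y (A \<omega>) = least_squares (A \<omega>) m" if "\<omega> \<in> space M" for \<omega>
    unfolding beta_star_def by (rule arg_min_eqI) (rule min_star[OF that])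

  have mu_hat_eq: "mu_hat i \<omega> = c i (fY \<omega>) \<bullet> gY \<omega>"
    and mu_star_eq: "mu_star i \<omega> = c i (fY \<omega>) \<bullet> m"
    and var_eq: "var i \<omega> = c i (fY \<omega>) \<bullet> (S' *v c i (fY \<omega>))" if "\<omega> \<in> space M" for i \<omega>
    unfolding mu_hat_def mu_star_def var_def hat[OF that] star[OF that]
    by (simp_all only: inner_least_squares[OF inv[OF that], unfolded A_eq]
        fit_variance_eq[OF inv[OF that], unfolded A_eq] quad c_def A_eq)
  have c_meas: "c i \<in> borel_measurable borel" for i
  proof (rule borel_measurable_vec)
    fix k
    have "(\<lambda>v. cramer_solution (transpose (D v) ** D v) (basis_vec (a v) (x i)) $ j) \<in> borel_measurable borel" for j
      by (rule borel_measurable_cramer_solution)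
         (simp_all add: D_def design_matrix_def basis_vec_def transpose_def matrix_matrix_mult_def)
    then show "(\<lambda>v. c i v $ k) \<in> borel_measurable borel"
      unfolding c_def fit_weights_def matrix_vector_mult_def
      by (simp add: D_def design_matrix_def basis_vec_def)
  qed

  have "cond_distributed M fY (mu_hat i) (\<lambda>\<omega>. normal_law (mu_star i \<omega>) (var i \<omega>))" for i
    by (rule cond_distributed_linear[OF fission c_meas[of i]]) (simp_all add: mu_hat_eq mu_star_eq var_eq)
  moreover have "AE \<omega> in M. cond_prob_given M fY {\<omega>' \<in> space M. mu_star i \<omega>' \<in>
        {mu_hat i \<omega>' - std_normal_upper_quantile (\<alpha> / 2) * sqrt (var i \<omega>') ..
         mu_hat i \<omega>' + std_normal_upper_quantile (\<alpha> / 2) * sqrt (var i \<omega>')}} \<omega>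
      = (if var i \<omega> = 0 then 1 else 1 - \<alpha>)" for i
  proof -
    \<comment> \<open>The interval is turned around: the target lies in an interval centred at the
      estimate exactly when the estimate lies in the interval of equal half-width centred at the
      target. The latter is an event about a normal variable near its mean.\<close>
    have event: "{\<omega>' \<in> space M. mu_star i \<omega>' \<in>
        {mu_hat i \<omega>' - std_normal_upper_quantile (\<alpha> / 2) * sqrt (var i \<omega>') ..
         mu_hat i \<omega>' + std_normal_upper_quantile (\<alpha> / 2) * sqrt (var i \<omega>')}} =
      {\<omega>' \<in> space M. \<bar>c i (fY \<omega>') \<bullet> gY \<omega>' - c i (fY \<omega>') \<bullet> m\<bar> \<le>
         std_normal_upper_quantile (\<alpha> / 2) * sqrt (c i (fY \<omega>') \<bullet> (S' *v c i (fY \<omega>')))}"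
      by (intro Collect_cong conj_cong refl) (auto simp: mu_hat_eq mu_star_eq var_eq abs_le_iff)
    have "0 < \<alpha> / 2" "\<alpha> / 2 < 1 / 2" using \<open>0 < \<alpha>\<close> \<open>\<alpha> < 1\<close> by auto
    from cond_prob_central_interval[OF fission S' c_meas[of i] this] AE_space
    show ?thesis unfolding event
      by eventually_elim (simp add: var_eq)
  qed
  then have "AE \<omega> in M.
      let h = (\<lambda>\<omega>'. std_normal_upper_quantile (\<alpha> / 2) * sqrt (var i \<omega>'));
          coverage = cond_prob_given M fY
            {\<omega>' \<in> space M. mu_star i \<omega>' \<in> {mu_hat i \<omega>' - h \<omega>' .. mu_hat i \<omega>' + h \<omega>'}} \<omega>
      in 1 - \<alpha> \<le> coverage \<and> (var i \<omega> \<noteq> 0 \<longrightarrow> coverage = 1 - \<alpha>)" for i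
    unfolding Let_def
    by (rule AE_mp[OF _ AE_I2]) (use \<open>0 < \<alpha>\<close> in auto)
  ultimately show ?thesis
    using min_hat min_star hat star unfolding m_def by blast
qed

end
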